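(* Let $f_c(z)=z^2+c$ with $c\notin\mathcal M$. Then $\mathbb P^1\setminus\mathcal J_c$ does not admit a bounded injective holomorphic function.
   Context: $\mathcal J_c$ denotes the Julia set of the polynomial $f_c(z)=z^2+c$, and $\mathcal M$ denotes the Mandelbrot set (the set of $c\in\mathbb C$ for which the orbit of $0$ under $f_c$ is bounded); for $c\notin\mathcal M$, $\mathcal J_c$ is a Cantor set. *)

theory Defs
  imports "HOL-Analysis.Analysis"
begin

definition quad_map :: "complex \<Rightarrow> complex \<Rightarrow> complex" where
  "quad_map c z = z^2 + c"

definition filled_julia :: "complex \<Rightarrow> complex set" where
  "filled_julia c = {z. bounded (range (\<lambda>n. (quad_map c ^^ n) z))}"

definition julia :: "complex \<Rightarrow> complex set" where
  "julia c = frontier (filled_julia c)"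

definition mandelbrot :: "complex set" where
  "mandelbrot = {c. bounded (range (\<lambda>n. (quad_map c ^^ n) 0))}"

text \<open>Riemann sphere modelled as complex option, None being the point at infinity.
  Chart at infinity: w maps to 1/w, with 0 mapping to infinity.\<close>
definition chart_inf :: "complex \<Rightarrow> complex option" where
  "chart_inf w = (if w = 0 then None else Some (inverse w))"

definition sphere_holomorphic_on :: "(complex option \<Rightarrow> complex) \<Rightarrow> complex option set \<Rightarrow> bool" where
  "sphere_holomorphic_on f U \<longleftrightarrow>
     (\<lambda>z. f (Some z)) holomorphic_on {z. Some z \<in> U} \<and>
     (None \<in> U \<longrightarrow> (\<lambda>w. f (chart_inf w)) holomorphic_on {w. chart_inf w \<in> U})"

end

theory Submission
  imports Defs "HOL-Complex_Analysis.Complex_Analysis"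
begin

text \<open>
  Write \<open>q\<close> for \<open>quad_map c\<close>. Since the critical orbit escapes, some sublevel set
  \<open>V = {z. norm ((q ^^ K) z) < \<rho>}\<close> is simply connected and misses the critical value \<open>c\<close>; so all
  inverse branches of all iterates of \<open>q\<close> are defined on \<open>V\<close>. Their images of one fixed ring
  \<open>A \<subseteq> V\<close> around the Julia set are pairwise disjoint, and each copy of \<open>A\<close> contains the corresponding
  copy of a connected level set \<open>\<Gamma>\<close>.

  Let \<open>f\<close> be univalent and bounded off the Julia set. The \<open>f\<close>-images of the copies of \<open>A\<close> are
  disjoint and bounded, so the total area of the \<open>2 ^ n\<close> images of level \<open>n\<close> is arbitrarily small for
  suitable \<open>n\<close>. By Bloch's theorem the squared diameter of the image of a copy of \<open>\<Gamma>\<close> is at most a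
  constant times the area of the image of the surrounding copy of \<open>A\<close>. So the images of the copies of
  \<open>\<Gamma>\<close> lie in discs of small total area, and some value \<open>f z0\<close> taken near infinity avoids all these
  discs. Replacing \<open>f\<close> inside every copy of \<open>\<Gamma>\<close> by a continuous extension with values in its disc gives
  a continuous map from the sphere to the plane that takes the value \<open>f z0\<close> only at \<open>z0\<close>, and with
  nonzero derivative there. This is impossible: off \<open>z0\<close> the difference to \<open>f z0\<close> would have a
  continuous logarithm, although it winds once around zero along a small circle around \<open>z0\<close>.
\<close>

section \<open>Areas, diameters and winding\<close>

text \<open>Since \<open>Y\<close> is the full preimage cut by an open set, its image is open in
  \<open>S\<close>; by compactness it is also closed in \<open>S\<close>, and connectedness leaves
  only \<open>S\<close> itself.\<close>

lemma open_map_image_clopen_compact: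
  fixes p :: "'a::t2_space \<Rightarrow> 'b::t2_space"
  assumes cont: "continuous_on UNIV p" and op: "\<And>U. open U \<Longrightarrow> open (p ` U)"
    and S: "connected S" and Y: "openin (top_of_set (p -` S)) Y" "compact Y" "Y \<noteq> {}"
  shows "p ` Y = S"
proof -
  obtain U where U: "open U" "Y = p -` S \<inter> U"
    using Y(1) by (auto simp: openin_open)
  have "p ` Y = S \<inter> p ` U"
    using U by auto
  then have "openin (top_of_set S) (p ` Y)"
    using op[OF U(1)] by auto
  moreover have "compact (p ` Y)"
    using Y(2) cont compact_continuous_image continuous_on_subset by blast
  then have "closedin (top_of_set S) (p ` Y)"
    using U by (auto intro!: closed_subset compact_imp_closed)
  ultimately show ?thesis
    using S Y(3) unfolding connected_clopen by blast
qed

text \<open>\<open>N\<close> bounds the number of \<epsilon>-steps between two points of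
  \<open>G\<close>, so it depends on neither \<open>F\<close> nor \<open>M\<close>. Being joined by
  finitely many steps is an equivalence relation with open classes; a finite \<epsilon>-net makes
  the number uniform.\<close>

lemma chain_bound_compact_connected:
  fixes G :: "'a::metric_space set"
  assumes "compact G" "connected G" "0 < \<epsilon>"
  obtains N :: real where "0 \<le> N"
    "\<And>(F::'a \<Rightarrow> 'b::metric_space) M x y. \<lbrakk>0 \<le> M; \<And>x y. \<lbrakk>x \<in> G; y \<in> G; dist x y < \<epsilon>\<rbrakk> \<Longrightarrow> dist (F x) (F y) \<le> M;
        x \<in> G; y \<in> G\<rbrakk> \<Longrightarrow> dist (F x) (F y) \<le> N * M"
proof -
  define Q where "Q F M \<longleftrightarrow> 0 \<le> M \<and> (\<forall>x\<in>G. \<forall>y\<in>G. dist x y < \<epsilon> \<longrightarrow> dist (F x) (F y) \<le> M)"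
    for F :: "'a \<Rightarrow> 'b" and M :: real
  define R where "R x y \<longleftrightarrow> (\<exists>N\<ge>0. \<forall>F M. Q F M \<longrightarrow> dist (F x) (F y) \<le> N * M)" for x y
  have R: "R x y" if "x \<in> G" "y \<in> G" for x y
  proof (rule connected_equivalence_relation[OF assms(2) that])
    show "R y x" if "R x y" for x y
      using that by (simp add: R_def dist_commute)
    show "R x z" if xy: "R x y" and yz: "R y z" for x y z
    proof -
      obtain N1 where N1: "N1 \<ge> 0" "\<And>F M. Q F M \<Longrightarrow> dist (F x) (F y) \<le> N1 * M"
        using xy by (auto simp: R_def)
      obtain N2 where N2: "N2 \<ge> 0" "\<And>F M. Q F M \<Longrightarrow> dist (F y) (F z) \<le> N2 * M"
        using yz by (auto simp: R_def)
      have "dist (F x) (F z) \<le> (N1 + N2) * M" if "Q F M" for F M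
        using dist_triangle[of "F x" "F z" "F y"] N1(2)[OF that] N2(2)[OF that]
        by (simp add: distrib_right)
      then show ?thesis
        unfolding R_def using N1 N2 by (intro exI[of _ "N1 + N2"]) auto
    qed
    show "\<exists>T. openin (top_of_set G) T \<and> a \<in> T \<and> (\<forall>x\<in>T. R a x)" if "a \<in> G" for a
    proof (intro exI conjI ballI)
      show "openin (top_of_set G) (G \<inter> ball a \<epsilon>)"
        by auto
      show "a \<in> G \<inter> ball a \<epsilon>"
        using that assms by auto
      show "R a x" if x: "x \<in> G \<inter> ball a \<epsilon>" for x
        unfolding R_def using x \<open>a \<in> G\<close> by (intro exI[of _ 1]) (auto simp: Q_def)
    qed
  qed
  have "G \<subseteq> (\<Union>x\<in>G. ball x \<epsilon>)"
    using assms(3) by force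
  then obtain D where D: "finite D" "D \<subseteq> G" "G \<subseteq> (\<Union>x\<in>D. ball x \<epsilon>)"
    using compactE_image[OF assms(1), of G "\<lambda>x. ball x \<epsilon>"] by (metis open_ball)
  obtain n where n: "\<And>x y. \<lbrakk>x \<in> G; y \<in> G\<rbrakk> \<Longrightarrow> n x y \<ge> 0 \<and> (\<forall>F M. Q F M \<longrightarrow> dist (F x) (F y) \<le> n x y * M)"
    using R unfolding R_def by metis
  \<comment> \<open>The sum dominates every \<open>n a b\<close> with net points \<open>a\<close>,
    \<open>b\<close>; the summand 2 pays for the steps from \<open>x\<close> and \<open>y\<close> to
    the net.\<close>
  define N where "N = 2 + (\<Sum>x\<in>D. \<Sum>y\<in>D. n x y)"
  have npos: "x \<in> D \<Longrightarrow> y \<in> D \<Longrightarrow> n x y \<ge> 0" for x y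
    using n D by blast
  show ?thesis
  proof
    show "0 \<le> N"
      unfolding N_def using npos by (intro add_nonneg_nonneg sum_nonneg) auto
  next
    fix F :: "'a \<Rightarrow> 'b" and M x y
    assume "0 \<le> M" "\<And>x y. \<lbrakk>x \<in> G; y \<in> G; dist x y < \<epsilon>\<rbrakk> \<Longrightarrow> dist (F x) (F y) \<le> M" and xy: "x \<in> G" "y \<in> G"
    then have Q: "Q F M"
      by (auto simp: Q_def)
    obtain a where a: "a \<in> D" "dist a x < \<epsilon>"
      using D(3) xy(1) by auto
    obtain b where b: "b \<in> D" "dist b y < \<epsilon>"
      using D(3) xy(2) by auto
    note ab = a b
    have abG: "a \<in> G" "b \<in> G"
      using ab D by auto
    have "n a b \<le> (\<Sum>y\<in>D. n a y)"
      using ab D npos by (intro member_le_sum) auto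
    also have "\<dots> \<le> (\<Sum>x\<in>D. \<Sum>y\<in>D. n x y)"
      using ab D npos by (intro member_le_sum[where f = "\<lambda>x. \<Sum>y\<in>D. n x y"] sum_nonneg) auto
    finally have le: "n a b + 2 \<le> N"
      by (simp add: N_def)
    have "dist (F x) (F y) \<le> dist (F a) (F x) + dist (F a) (F b) + dist (F b) (F y)"
      by metric
    also have "dist (F a) (F x) \<le> M"
      using Q ab abG xy by (auto simp: Q_def)
    also have "dist (F b) (F y) \<le> M"
      using Q ab abG xy by (auto simp: Q_def)
    also have "dist (F a) (F b) \<le> n a b * M"
      using n[OF abG] Q by blast
    finally have "dist (F x) (F y) \<le> (n a b + 2) * M"
      by (simp add: algebra_simps)
    also have "\<dots> \<le> N * M"
      using le \<open>0 \<le> M\<close> by (rule mult_right_mono)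
    finally show "dist (F x) (F y) \<le> N * M" .
  qed
qed

text \<open>Bloch's theorem puts a disc of radius \<open>\<epsilon> * norm (deriv F z) / 12\<close>
  into the image, and its area is at most that of the image.\<close>

lemma norm_deriv_le_area:
  fixes F :: "complex \<Rightarrow> complex"
  assumes hol: "F holomorphic_on S" and "0 < \<epsilon>" "ball z \<epsilon> \<subseteq> S"
    and meas: "F ` S \<in> fmeasurable lborel"
  shows "norm (deriv F z) \<le> 12 / \<epsilon> * sqrt (measure lborel (F ` S) / pi)"
proof -
  define d where "d = \<epsilon> * norm (deriv F z) / 12"
  have "d \<ge> 0"
    using assms by (simp add: d_def)
  obtain b where b: "ball b d \<subseteq> F ` ball z \<epsilon>"
    using Bloch[of F z \<epsilon> d] hol assms holomorphic_on_subset unfolding d_def by blast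
  then have "ball b d \<subseteq> F ` S"
    using assms(3) by blast
  then have "measure lborel (ball b d) \<le> measure lborel (F ` S)"
    using meas by (intro measure_mono_fmeasurable) auto
  then have "pi * d ^ 2 \<le> measure lborel (F ` S)"
    using content_ball[OF \<open>d \<ge> 0\<close>, of b] by (simp add: unit_ball_vol_2)
  then have "d \<le> sqrt (measure lborel (F ` S) / pi)"
    by (intro real_le_rsqrt) (simp add: field_simps)
  then show ?thesis
    using assms(2) by (simp add: d_def field_simps)
qed

text \<open>Area bounds the derivative near \<open>G\<close>, hence the effect of short steps in
  \<open>G\<close>, and chaining does the rest. \<open>C\<close> depends only on \<open>A\<close>
  and \<open>G\<close>, so that it serves all inverse branches at once.\<close>

lemma dist_squared_le_area:
  fixes A G :: "complex set"
  assumes "open A" "compact G" "connected G" "G \<subseteq> A"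
  obtains C where "0 \<le> C"
    "\<And>F x y. \<lbrakk>F holomorphic_on A; F ` A \<in> fmeasurable lborel; x \<in> G; y \<in> G\<rbrakk>
        \<Longrightarrow> (dist (F x) (F y))\<^sup>2 \<le> C * measure lborel (F ` A)"
proof -
  \<comment> \<open>The factor 2 leaves room: a ball of radius \<epsilon> about any point of
    \<open>ball x \<epsilon>\<close> still lies in \<open>A\<close>.\<close>
  obtain \<epsilon> where \<epsilon>: "\<epsilon> > 0" "\<And>x. x \<in> G \<Longrightarrow> ball x (2 * \<epsilon>) \<subseteq> A"
  proof -
    obtain e where "e > 0" "(\<Union>x\<in>G. ball x e) \<subseteq> A"
      using compact_subset_open_imp_ball_epsilon_subset[OF assms(2,1,4)] by blast
    then show ?thesis
      using that[of "e / 2"] by auto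
  qed
  obtain N :: real where N: "N \<ge> 0"
    "\<And>(F::complex \<Rightarrow> complex) M x y. \<lbrakk>0 \<le> M; \<And>x y. \<lbrakk>x \<in> G; y \<in> G; dist x y < \<epsilon>\<rbrakk> \<Longrightarrow> dist (F x) (F y) \<le> M;
        x \<in> G; y \<in> G\<rbrakk> \<Longrightarrow> dist (F x) (F y) \<le> N * M"
    using chain_bound_compact_connected[OF assms(2,3) \<epsilon>(1)] by metis
  show ?thesis
  proof
    show "0 \<le> (N * 12)\<^sup>2 / pi"
      by simp
  next
    fix F x y
    assume F: "F holomorphic_on A" "F ` A \<in> fmeasurable lborel" and xy: "x \<in> G" "y \<in> G"
    define m where "m = sqrt (measure lborel (F ` A) / pi)"
    have local_bound: "dist (F x) (F y) \<le> 12 * m" if "x \<in> G" "y \<in> G" "dist x y < \<epsilon>" for x y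
    proof -
      have der: "(F has_field_derivative deriv F z) (at z within ball x \<epsilon>)"
        "norm (deriv F z) \<le> 12 / \<epsilon> * m" if z: "z \<in> ball x \<epsilon>" for z
      proof -
        have "ball z \<epsilon> \<subseteq> ball x (2 * \<epsilon>)"
          using z by (intro subsetI) (simp, metric)
        then have sub: "ball z \<epsilon> \<subseteq> A"
          using \<epsilon>(2)[OF \<open>x \<in> G\<close>] by blast
        then show "norm (deriv F z) \<le> 12 / \<epsilon> * m"
          unfolding m_def by (intro norm_deriv_le_area F \<epsilon>)
        have "z \<in> A"
          using sub \<epsilon>(1) by auto
        then show "(F has_field_derivative deriv F z) (at z within ball x \<epsilon>)"
          using F(1) assms(1) holomorphic_derivI by blast
      qed
      have "norm (F y - F x) \<le> 12 / \<epsilon> * m * norm (y - x)"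
        using that der \<epsilon>(1) by (intro field_differentiable_bound[of "ball x \<epsilon>" F "deriv F"]) auto
      also have "\<dots> \<le> 12 / \<epsilon> * m * \<epsilon>"
        using that \<epsilon>(1) by (intro mult_left_mono) (auto simp: dist_norm norm_minus_commute m_def)
      finally show ?thesis
        using \<epsilon>(1) by (simp add: dist_norm norm_minus_commute)
    qed
    have "0 \<le> 12 * m"
      by (simp add: m_def)
    then have "dist (F x) (F y) \<le> N * (12 * m)"
      using N(2)[of "12 * m" F x y] local_bound xy by blast
    then have "(dist (F x) (F y))\<^sup>2 \<le> (N * (12 * m))\<^sup>2"
      by (intro power_mono) auto
    also have "\<dots> = (N * 12)\<^sup>2 / pi * measure lborel (F ` A)"
      by (simp add: m_def power_mult_distrib)
    finally show "(dist (F x) (F y))\<^sup>2 \<le> (N * 12)\<^sup>2 / pi * measure lborel (F ` A)" .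
  qed
qed

text \<open>Otherwise the circle would be the exponential of a closed path and so have winding
  number 0 about 0, whereas it winds once.\<close>

lemma no_continuous_log_on_circle:
  fixes l :: "complex \<Rightarrow> complex"
  assumes "0 < r" "continuous_on (sphere 0 r) l"
  shows "\<exists>u \<in> sphere 0 r. exp (l u) \<noteq> u"
proof (rule ccontr)
  assume "\<not> ?thesis"
  then have l: "exp (l u) = u" if "u \<in> sphere 0 r" for u
    using that by auto
  have im: "path_image (circlepath 0 r) = sphere 0 r"
    using assms by simp
  have "path (l \<circ> circlepath 0 r)"
    using assms im by (intro path_continuous_image) auto
  then have "winding_number (exp \<circ> (l \<circ> circlepath 0 r)) 0 = 0"
    using winding_number_compose_exp[of "l \<circ> circlepath 0 r"]
    by (simp add: pathfinish_compose pathstart_compose)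
  moreover have "winding_number (exp \<circ> (l \<circ> circlepath 0 r)) 0 = winding_number (circlepath 0 r) 0"
  proof (rule winding_number_cong)
    show "(exp \<circ> (l \<circ> circlepath 0 r)) t = circlepath 0 r t" if "0 \<le> t" "t \<le> 1" for t
    proof -
      have "circlepath 0 r t \<in> sphere 0 r"
        unfolding im[symmetric] path_image_def using that by auto
      then show ?thesis
        using l by simp
    qed
  qed
  ultimately show False
    using winding_number_circlepath[of 0 0 r] assms by simp
qed

text \<open>In the coordinate \<open>u = 1 / (z - z0)\<close> the difference to \<open>F z0\<close>
  is a zero-free continuous function \<open>G\<close> on the plane and has a logarithm. Since
  \<open>u * G u\<close> tends to \<open>d\<close> as \<open>u\<close> tends to infinity,
  \<open>u\<close> itself would have one on a large circle.\<close>

lemma unique_simple_value_impossible: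
  fixes F :: "complex \<Rightarrow> complex"
  assumes cont: "continuous_on UNIV F" and lim: "(F \<longlongrightarrow> l) at_infinity" and "l \<noteq> F z0"
    and uniq: "\<And>z. F z = F z0 \<Longrightarrow> z = z0"
    and der: "(F has_field_derivative d) (at z0)" and "d \<noteq> 0"
  shows False
proof -
  define G where "G u = (if u = 0 then l else F (z0 + inverse u)) - F z0" for u
  have contG: "continuous_on UNIV G"
  proof -
    have "isCont G u" for u
    proof (cases "u = 0")
      case True
      have "filterlim (\<lambda>u. z0 + inverse u) at_infinity (at 0)"
        by (intro tendsto_add_filterlim_at_infinity[OF tendsto_const] filterlim_inverse_at_infinity)
      then have "((\<lambda>u. F (z0 + inverse u) - F z0) \<longlongrightarrow> l - F z0) (at 0)"
        using lim by (intro tendsto_diff tendsto_const) (rule filterlim_compose)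
      then have "(G \<longlongrightarrow> l - F z0) (at 0)"
        by (rule Lim_transform_eventually) (auto simp: G_def eventually_at_filter)
      then show ?thesis
        using True by (simp add: isCont_def G_def)
    next
      case False
      have "isCont F (z0 + inverse u)"
        using cont by (simp add: continuous_on_eq_continuous_at)
      moreover have "isCont (\<lambda>v. z0 + inverse v) u"
        using False by (simp add: continuous_at_within_inverse)
      ultimately have "isCont (\<lambda>v. F (z0 + inverse v)) u"
        by (rule isCont_o2[rotated])
      then have "isCont (\<lambda>v. F (z0 + inverse v) - F z0) u"
        by (intro continuous_diff continuous_const)
      moreover have "\<forall>\<^sub>F v in nhds u. G v = F (z0 + inverse v) - F z0"
        using t1_space_nhds[OF False] by eventually_elim (auto simp: G_def)
      ultimately show ?thesis
        using isCont_cong[of G "\<lambda>v. F (z0 + inverse v) - F z0" u] by blast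
    qed
    then show ?thesis
      by (simp add: continuous_on_eq_continuous_at)
  qed
  have "G u \<noteq> 0" for u
    using uniq[of "z0 + inverse u"] \<open>l \<noteq> F z0\<close> by (auto simp: G_def)
  then obtain L where L: "continuous_on UNIV L" "\<And>u. G u = exp (L u)"
    using continuous_logarithm_on_contractible[OF contG] by (metis contractible_UNIV UNIV_I)
  have "((\<lambda>h. (F (z0 + h) - F z0) / h) \<longlongrightarrow> d) (at 0)"
    using der by (simp add: DERIV_def)
  moreover have "filterlim (\<lambda>u. inverse u) (at (0::complex)) at_infinity"
    using filterlim_inverse_at_iff[of "\<lambda>u::complex. u" at_infinity] by (simp add: filterlim_ident)
  ultimately have "((\<lambda>u. (F (z0 + inverse u) - F z0) / inverse u) \<longlongrightarrow> d) at_infinity"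
    by (rule filterlim_compose)
  then have "\<forall>\<^sub>F u in at_infinity. dist ((F (z0 + inverse u) - F z0) / inverse u) d < norm d"
    using \<open>d \<noteq> 0\<close> by (intro tendstoD) auto
  then obtain b where b: "\<And>u. norm u \<ge> b \<Longrightarrow> dist ((F (z0 + inverse u) - F z0) / inverse u) d < norm d"
    by (auto simp: eventually_at_infinity)
  define r where "r = max b 1"
  have r: "r > 0" "r \<ge> b"
    by (auto simp: r_def)
  have near: "dist (u * G u) d < norm d" if "u \<in> sphere 0 r" for u
    using b[of u] that r by (auto simp: G_def field_simps)
  have pos: "u * G u / d \<notin> \<real>\<^sub>\<le>\<^sub>0" if "u \<in> sphere 0 r" for u
  proof -
    have "norm (u * G u / d - 1) = norm (u * G u - d) / norm d"
      using \<open>d \<noteq> 0\<close> by (simp flip: norm_divide add: diff_divide_distrib)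
    also have "\<dots> < 1"
      using near[OF that] \<open>d \<noteq> 0\<close> by (simp add: dist_norm)
    finally have "\<bar>Re (u * G u / d - 1)\<bar> < 1"
      using abs_Re_le_cmod le_less_trans by blast
    then have "Re (u * G u / d) > 0"
      by simp
    then show ?thesis
      by (auto simp: complex_nonpos_Reals_iff)
  qed
  \<comment> \<open>\<open>u\<close> is the product of \<open>u * G u / d\<close> and
    \<open>d\<close>, divided by \<open>G u\<close>; the first factor lies within distance 1 of 1,
    where \<open>Ln\<close> is continuous.\<close>
  define m where "m u = Ln (u * G u / d) + Ln d - L u" for u
  have "continuous_on (sphere 0 r) m"
    unfolding m_def using pos \<open>d \<noteq> 0\<close>
    by (intro continuous_intros continuous_on_subset[OF contG] continuous_on_subset[OF L(1)]) auto
  moreover have "exp (m u) = u" if u: "u \<in> sphere 0 r" for u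
  proof -
    have "u * G u / d \<noteq> 0"
      using pos[OF u] by auto
    then have "exp (m u) = u * G u / d * d / exp (L u)"
      using \<open>d \<noteq> 0\<close> by (simp add: m_def exp_diff exp_add)
    then show ?thesis
      using \<open>d \<noteq> 0\<close> L(2)[of u] by simp
  qed
  ultimately show False
    using no_continuous_log_on_circle[OF r(1)] by blast
qed

section \<open>Dynamics of quadratic maps\<close>

text \<open>This fixes the escape radius. The doubling, beyond mere growth, later separates the
  rings of different levels.\<close>

lemma norm_quad_map_ge:
  assumes "norm c + 2 \<le> norm z"
  shows "2 * norm z \<le> norm (quad_map c z)"
proof -
  have "norm (z\<^sup>2 + c) \<ge> norm (z\<^sup>2) - norm c"
    by (metis norm_diff_ineq)
  moreover have "(norm c + 2) * norm z \<le> norm z * norm z"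
    using assms by (intro mult_right_mono) auto
  moreover have "norm c * 1 \<le> norm c * norm z"
    using assms norm_ge_zero[of c] by (intro mult_left_mono) linarith+
  ultimately show ?thesis
    by (simp add: quad_map_def norm_mult power2_eq_square distrib_right)
qed

lemma norm_quad_map_iter_ge:
  assumes "norm c + 2 \<le> norm z"
  shows "2 ^ n * norm z \<le> norm ((quad_map c ^^ n) z)"
proof (induction n)
  case (Suc n)
  have "1 * norm z \<le> 2 ^ n * norm z"
    by (intro mult_right_mono) auto
  then have "norm c + 2 \<le> norm ((quad_map c ^^ n) z)"
    using Suc assms by linarith
  from norm_quad_map_ge[OF this] show ?case
    using Suc by simp
qed auto

lemma norm_quad_map_iter_ge_self:
  assumes "norm c + 2 \<le> norm z"
  shows "norm z \<le> norm ((quad_map c ^^ n) z)"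
proof -
  have "1 * norm z \<le> 2 ^ n * norm z"
    by (intro mult_right_mono) auto
  then show ?thesis
    using norm_quad_map_iter_ge[OF assms, of n] by linarith
qed

lemma unbounded_quad_map_orbit:
  assumes "norm c + 2 \<le> norm ((quad_map c ^^ n) z)"
  shows "\<not> bounded (range (\<lambda>n. (quad_map c ^^ n) z))"
proof
  assume "bounded (range (\<lambda>n. (quad_map c ^^ n) z))"
  then obtain B where B: "\<And>n. norm ((quad_map c ^^ n) z) \<le> B"
    by (auto simp: bounded_iff)
  obtain m where m: "B < 2 ^ m"
    using real_arch_pow[of 2 B] by auto
  have "2 ^ m * 1 \<le> 2 ^ m * norm ((quad_map c ^^ n) z)"
    using assms norm_ge_zero[of c] by (intro mult_left_mono; linarith?) simp
  also have "\<dots> \<le> norm ((quad_map c ^^ (m + n)) z)"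
    using norm_quad_map_iter_ge[OF assms] by (simp add: funpow_add)
  finally show False
    using B[of "m + n"] m by simp
qed

section \<open>Iterates as open holomorphic maps\<close>

lemma holomorphic_quad_map_iter: "(quad_map c ^^ n) holomorphic_on S"
proof (induction n)
  case 0
  show ?case
    by (simp add: id_def)
next
  case (Suc n)
  have "(\<lambda>z. ((quad_map c ^^ n) z)\<^sup>2 + c) holomorphic_on S"
    using Suc by (intro holomorphic_intros)
  moreover have "(quad_map c ^^ Suc n) z = ((quad_map c ^^ n) z)\<^sup>2 + c" for z
    by (simp add: quad_map_def)
  ultimately show ?case
    by (metis (no_types, lifting) holomorphic_transform)
qed

lemma continuous_quad_map_iter: "continuous_on S (quad_map c ^^ n)"
  by (intro holomorphic_on_imp_continuous_on holomorphic_quad_map_iter)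

lemma open_image_quad_map:
  assumes "open U"
  shows "open (quad_map c ` U)"
proof (rule open_mapping_thm[of "quad_map c" UNIV U])
  show "quad_map c holomorphic_on UNIV"
    using holomorphic_quad_map_iter[of 1 c] by simp
  show "\<not> quad_map c constant_on UNIV"
  proof
    assume "quad_map c constant_on UNIV"
    then have "quad_map c 0 = quad_map c 1"
      unfolding constant_on_def by (metis UNIV_I)
    then show False
      by (simp add: quad_map_def)
  qed
qed (use assms in auto)

lemma open_image_quad_map_iter:
  assumes "open U"
  shows "open ((quad_map c ^^ n) ` U)"
proof (induction n)
  case (Suc n)
  then show ?case
    using open_image_quad_map[of "(quad_map c ^^ n) ` U" c] by (simp add: image_comp)
qed (use assms in simp)

text \<open>An orbit that reaches the escape radius grows geometrically, so a bounded orbit stays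
  within it. This form shows that the filled Julia set is closed.\<close>

lemma filled_julia_eq: "filled_julia c = (\<Inter>n. {z. norm ((quad_map c ^^ n) z) \<le> norm c + 2})"
proof (intro set_eqI iffI)
  fix z
  assume "z \<in> filled_julia c"
  then have "\<not> norm c + 2 \<le> norm ((quad_map c ^^ n) z)" for n
    using unbounded_quad_map_orbit[of c n z] by (auto simp: filled_julia_def)
  then show "z \<in> (\<Inter>n. {z. norm ((quad_map c ^^ n) z) \<le> norm c + 2})"
    by (simp add: not_le less_imp_le)
qed (auto simp: filled_julia_def bounded_iff)

lemma escape_not_in_julia:
  assumes "norm c + 2 < norm ((quad_map c ^^ n) z)"
  shows "z \<notin> julia c"
proof -
  have "closed (filled_julia c)"
    unfolding filled_julia_eq
    by (intro closed_INT ballI closed_Collect_le continuous_intros continuous_quad_map_iter)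
  then have "julia c \<subseteq> filled_julia c"
    by (simp add: julia_def frontier_subset_closed)
  moreover have "z \<notin> filled_julia c"
    using assms by (auto simp: filled_julia_eq not_le)
  ultimately show ?thesis
    by blast
qed

text \<open>Every relatively clopen piece of the preimage maps onto \<open>S\<close>, hence contains the
  critical point, the only preimage of \<open>c\<close>.\<close>
lemma connected_vimage_quad_map:
  assumes "compact S" "connected S" "c \<in> S"
  shows "compact (quad_map c -` S)" "connected (quad_map c -` S)"
proof -
  have cont: "continuous_on UNIV (quad_map c)"
    using continuous_quad_map_iter[of UNIV 1 c] by simp
  obtain B where B: "\<And>z. z \<in> S \<Longrightarrow> norm z \<le> B"
    using compact_imp_bounded[OF assms(1)] by (auto simp: bounded_iff)
  have "norm z \<le> max B (norm c + 2)" if "quad_map c z \<in> S" for z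
    using B[OF that] norm_quad_map_ge[of c z] norm_ge_zero[of z] by linarith
  then have "bounded (quad_map c -` S)"
    by (auto simp: bounded_iff)
  moreover have "closed (quad_map c -` S)"
    using assms(1) cont by (intro closed_vimage compact_imp_closed)
  ultimately show comp: "compact (quad_map c -` S)"
    by (simp add: compact_eq_bounded_closed)
  have zero: "0 \<in> Y" if Y: "openin (top_of_set (quad_map c -` S)) Y"
    "closedin (top_of_set (quad_map c -` S)) Y" "Y \<noteq> {}" for Y
  proof -
    have "quad_map c ` Y = S"
      using open_map_image_clopen_compact[OF cont open_image_quad_map assms(2) Y(1) _ Y(3)]
        closedin_compact[OF comp Y(2)] by simp
    then show ?thesis
      using assms(3) by (auto simp: quad_map_def)
  qed
  show "connected (quad_map c -` S)"
    unfolding connected_clopen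
  proof (intro allI impI, elim conjE)
    fix Y
    assume Y: "openin (top_of_set (quad_map c -` S)) Y" "closedin (top_of_set (quad_map c -` S)) Y"
    let ?Z = "quad_map c -` S - Y"
    have "openin (top_of_set (quad_map c -` S)) ?Z" "closedin (top_of_set (quad_map c -` S)) ?Z"
      using Y by auto
    then show "Y = {} \<or> Y = quad_map c -` S"
      using zero[OF Y] zero[of ?Z] openin_imp_subset[OF Y(1)] by blast
  qed
qed

text \<open>A clopen piece that misses the connected outer region is bounded, hence compact, and if
  nonempty it would map onto an unbounded set. So the piece containing the outer region is
  everything.\<close>

lemma connected_outer_level:
  assumes "norm c + 2 \<le> \<rho>"
  shows "connected {z. \<rho> \<le> norm ((quad_map c ^^ n) z)}"
proof -
  let ?P = "quad_map c ^^ n"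
  have out: "connected {z::complex. \<rho> \<le> norm z}"
  proof -
    have "{z::complex. \<rho> \<le> norm z} = - ball 0 \<rho>"
      by auto
    then show ?thesis
      by (simp add: connected_complement_bounded_convex)
  qed
  have eq: "{z. \<rho> \<le> norm (?P z)} = ?P -` {z. \<rho> \<le> norm z}" (is "?X = _")
    by auto
  have sub: "{z. \<rho> \<le> norm z} \<subseteq> ?X"
    using assms order_trans norm_quad_map_iter_ge_self[of c _ n] by fastforce
  have closedX: "closed ?X"
    by (intro closed_Collect_le continuous_intros continuous_quad_map_iter)
  have nobdd: "Y = {}" if Y: "openin (top_of_set ?X) Y" "closedin (top_of_set ?X) Y"
    and disj: "{z. \<rho> \<le> norm z} \<inter> Y = {}" for Y
  proof (rule ccontr)
    assume "Y \<noteq> {}"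
    have "bounded Y"
      unfolding bounded_iff using disj by (intro exI[of _ \<rho>]) force
    moreover have "closed Y"
      using Y(2) closedX by (simp add: closedin_closed_eq)
    ultimately have comp: "compact Y"
      by (simp add: compact_eq_bounded_closed)
    then have "?P ` Y = {z. \<rho> \<le> norm z}"
      using Y(1) \<open>Y \<noteq> {}\<close> unfolding eq
      by (intro open_map_image_clopen_compact[OF continuous_quad_map_iter open_image_quad_map_iter out])
    moreover have "compact (?P ` Y)"
      using comp by (intro compact_continuous_image continuous_quad_map_iter)
    ultimately have "bounded {z::complex. \<rho> \<le> norm z}"
      by (simp add: compact_imp_bounded)
    then obtain B where B: "\<And>z::complex. \<rho> \<le> norm z \<Longrightarrow> norm z \<le> B"
      by (auto simp: bounded_iff)
    show False
      using B[of "of_real (\<bar>\<rho>\<bar> + \<bar>B\<bar> + 1)"] unfolding norm_of_real by linarith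
  qed
  show ?thesis
    unfolding connected_clopen
  proof (intro allI impI, elim conjE)
    fix Y
    assume Y: "openin (top_of_set ?X) Y" "closedin (top_of_set ?X) Y"
    have Z: "openin (top_of_set ?X) (?X - Y)" "closedin (top_of_set ?X) (?X - Y)"
      using Y by auto
    have "openin (top_of_set {z. \<rho> \<le> norm z}) ({z. \<rho> \<le> norm z} \<inter> Y)"
      using Y(1) sub openin_Int_open unfolding openin_open by blast
    moreover have "closedin (top_of_set {z. \<rho> \<le> norm z}) ({z. \<rho> \<le> norm z} \<inter> Y)"
      using Y(2) sub unfolding closedin_closed by blast
    ultimately have "{z. \<rho> \<le> norm z} \<inter> Y = {} \<or> {z. \<rho> \<le> norm z} \<inter> Y = {z. \<rho> \<le> norm z}"
      using out unfolding connected_clopen by blast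
    then show "Y = {} \<or> Y = ?X"
    proof
      assume "{z. \<rho> \<le> norm z} \<inter> Y = {z. \<rho> \<le> norm z}"
      then have "?X - Y = {}"
        by (intro nobdd[OF Z]) blast
      then show ?thesis
        using openin_imp_subset[OF Y(1)] by blast
    qed (simp add: nobdd[OF Y])
  qed
qed

section \<open>Inverse branches coded by words of signs\<close>

primrec branch :: "(complex \<Rightarrow> complex) \<Rightarrow> bool list \<Rightarrow> complex \<Rightarrow> complex" where
  "branch h [] z = z"
| "branch h (b # w) z = (if b then h (branch h w z) else - h (branch h w z))"

text \<open>\<open>h\<close> is a square root of \<open>z - c\<close>; both roots lie in the
  backward invariant \<open>V\<close>, so they can be composed freely. The head of a word picks the
  sign of the last root taken.\<close>

locale quad_sqrt_branch =
  fixes c :: complex and V :: "complex set" and h :: "complex \<Rightarrow> complex"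
  assumes c_notin: "c \<notin> V" and vimage_V: "quad_map c -` V \<subseteq> V"
    and hol_h: "h holomorphic_on V" and quad_h: "\<And>z. z \<in> V \<Longrightarrow> quad_map c (h z) = z"
begin

lemma quad_minus_h: "z \<in> V \<Longrightarrow> quad_map c (- h z) = z"
  using quad_h by (simp add: quad_map_def)

lemma branch_in: "z \<in> V \<Longrightarrow> branch h w z \<in> V"
proof (induction w)
  case (Cons b w)
  then show ?case
    using vimage_V quad_h[of "branch h w z"] quad_minus_h[of "branch h w z"] by auto
qed simp

lemma quad_branch_Cons: "z \<in> V \<Longrightarrow> quad_map c (branch h (b # w) z) = branch h w z"
  using branch_in[of z w] quad_h quad_minus_h by simp

lemma quad_iter_branch: "z \<in> V \<Longrightarrow> (quad_map c ^^ length w) (branch h w z) = z"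
proof (induction w)
  case (Cons b w)
  then show ?case
    using quad_branch_Cons[of z b w] by (simp add: funpow_swap1 del: branch.simps)
qed simp

lemma holomorphic_branch: "branch h w holomorphic_on V"
proof (induction w)
  case Nil
  show ?case
    by simp
next
  case (Cons b w)
  have "(h \<circ> branch h w) holomorphic_on V"
    using branch_in by (intro holomorphic_on_compose_gen[OF Cons hol_h]) auto
  moreover from this have "(\<lambda>z. - (h \<circ> branch h w) z) holomorphic_on V"
    by (intro holomorphic_intros)
  ultimately show ?case
    by (cases b) (simp_all add: o_def)
qed

lemma inj_on_branch: "inj_on (branch h w) V"
  by (metis inj_onI quad_iter_branch)

text \<open>The word is read off the orbit: by induction \<open>quad_map c x\<close> is a branch
  value, hence in \<open>V\<close>, and \<open>x\<close> is plus or minus its root.\<close>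

lemma branch_surj:
  "(quad_map c ^^ n) x \<in> V \<Longrightarrow> \<exists>w. length w = n \<and> branch h w ((quad_map c ^^ n) x) = x"
proof (induction n arbitrary: x)
  case (Suc n)
  have eq: "(quad_map c ^^ Suc n) x = (quad_map c ^^ n) (quad_map c x)"
    by (simp add: funpow_swap1)
  then obtain w where w: "length w = n" "branch h w ((quad_map c ^^ Suc n) x) = quad_map c x"
    using Suc by metis
  have "quad_map c x \<in> V"
    using branch_in[OF Suc.prems, of w] w by simp
  from quad_h[OF this] have "(h (quad_map c x))\<^sup>2 = x\<^sup>2"
    by (simp add: quad_map_def)
  then have "x = h (quad_map c x) \<or> x = - h (quad_map c x)"
    by (auto simp: power2_eq_iff)
  then have "branch h (True # w) ((quad_map c ^^ Suc n) x) = x \<or>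
      branch h (False # w) ((quad_map c ^^ Suc n) x) = x"
    unfolding branch.simps w(2) by auto
  then show ?case
    using w(1) by (metis length_Cons)
qed simp

text \<open>Applying \<open>quad_map c\<close> strips the head, so the tails agree by induction. The
  signs agree because \<open>h\<close> vanishes nowhere on \<open>V\<close>: a zero would put
  \<open>c\<close> into \<open>V\<close>.\<close>

lemma branch_unique:
  "\<lbrakk>length w = length w'; branch h w z = branch h w' z'; z \<in> V; z' \<in> V\<rbrakk> \<Longrightarrow> w = w'"
proof (induction w w' rule: list_induct2)
  case (Cons b w b' w')
  have eq: "branch h w z = branch h w' z'"
    using Cons.prems quad_branch_Cons by metis
  then have "w = w'"
    using Cons by blast
  moreover have "h (branch h w z) \<noteq> 0"
    using quad_h[OF branch_in[OF Cons.prems(2), of w]] branch_in[OF Cons.prems(2), of w] c_notin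
    by (auto simp: quad_map_def)
  then have "b = b'"
    using Cons.prems(1) eq by (auto split: if_splits)
  ultimately show ?case
    by simp
qed simp

end

text \<open>\<open>K + 1\<close> is the first time at which the critical orbit exceeds the escape
  radius. The first \<open>K\<close> pullbacks of a large disc are therefore taken of sets that
  contain the critical value \<open>c\<close> and stay connected, while \<open>K\<close> iterates do
  carry \<open>c\<close> beyond the radius.\<close>

lemma escaping_quad_structure:
  assumes "c \<notin> mandelbrot"
  obtains K \<rho> h where "norm c + 2 < \<rho>" "\<rho> \<le> 2 * (norm c + 2)"
    "quad_sqrt_branch c {z. norm ((quad_map c ^^ K) z) < \<rho>} h"
    "\<And>r. norm c + 2 \<le> r \<Longrightarrow> compact {z. norm ((quad_map c ^^ K) z) \<le> r}"
    "\<And>r. norm c + 2 \<le> r \<Longrightarrow> connected {z. norm ((quad_map c ^^ K) z) = r}"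
proof -
  let ?q = "quad_map c" and ?R = "norm c + 2"
  have ex: "\<exists>n. ?R < norm ((?q ^^ n) 0)"
  proof (rule ccontr)
    assume "\<not> ?thesis"
    then have "\<And>n. norm ((?q ^^ n) 0) \<le> ?R"
      by (simp add: not_less)
    then show False
      using assms by (auto simp: mandelbrot_def bounded_iff)
  qed
  define m where "m = (LEAST n. ?R < norm ((?q ^^ n) 0))"
  have m: "?R < norm ((?q ^^ m) 0)"
    unfolding m_def using ex by (rule LeastI_ex)
  have below: "norm ((?q ^^ j) 0) \<le> ?R" if "j < m" for j
    using not_less_Least[of j] that by (fastforce simp: m_def)
  have "m \<noteq> 0"
    using m norm_ge_zero[of c] by (intro notI) (simp del: norm_ge_zero)
  then obtain K where K: "m = Suc K"
    using not0_implies_Suc by blast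
  let ?P = "?q ^^ K"
  have step: "(?q ^^ j) c = (?q ^^ Suc j) 0" for j
  proof -
    have "?q 0 = c"
      by (simp add: quad_map_def)
    then show ?thesis
      by (simp only: funpow_Suc_right o_apply)
  qed
  have inner: "compact {z. norm ((?q ^^ j) z) \<le> r} \<and> connected {z. norm ((?q ^^ j) z) \<le> r}"
    if "j \<le> K" "?R \<le> r" for j r
    using that(1)
  proof (induction j)
    case 0
    have "{z::complex. norm z \<le> r} = cball 0 r"
      by auto
    then show ?case
      by (simp add: convex_connected)
  next
    case (Suc j)
    have eq: "{z. norm ((?q ^^ Suc j) z) \<le> r} = ?q -` {z. norm ((?q ^^ j) z) \<le> r}"
      by (auto simp: funpow_swap1)
    have "norm ((?q ^^ j) c) \<le> r"
      using below[of "Suc j"] Suc.prems K that(2) unfolding step by simp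
    then show ?case
      unfolding eq using Suc connected_vimage_quad_map[of "{z. norm ((?q ^^ j) z) \<le> r}" c] by simp
  qed
  \<comment> \<open>The bound \<open>norm (?P c)\<close> keeps \<open>c\<close> out of
    \<open>V\<close>; the bound \<open>2 * ?R\<close> ensures that a point with norm between
    \<open>?R\<close> and \<rho> has norm at least \<rho> after any further iterates.\<close>
  define \<rho> where "\<rho> = min (norm (?P c)) (2 * ?R)"
  define V where "V = {z. norm (?P z) < \<rho>}"
  have \<rho>: "?R < \<rho>" "\<rho> \<le> 2 * ?R" "\<rho> \<le> norm (?P c)"
    using m norm_ge_zero[of c] unfolding step \<rho>_def K by (auto simp del: norm_ge_zero)
  have "open V"
    unfolding V_def by (intro open_Collect_less continuous_intros continuous_quad_map_iter)
  have vimage_V: "?q -` V \<subseteq> V"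
  proof
    fix z
    assume "z \<in> ?q -` V"
    then have z: "norm (?q (?P z)) < \<rho>"
      by (simp add: V_def funpow_swap1)
    show "z \<in> V"
    proof (rule ccontr)
      assume "z \<notin> V"
      then have "\<rho> \<le> norm (?P z)"
        by (simp add: V_def)
      then show False
        using norm_quad_map_ge[of c "?P z"] z \<rho> norm_ge_zero[of c] by linarith
    qed
  qed
  have "bounded V"
    unfolding bounded_iff
  proof (intro exI ballI)
    fix z
    assume "z \<in> V"
    then show "norm z \<le> \<rho>"
      using norm_quad_map_iter_ge_self[of c z K] \<rho> unfolding V_def by force
  qed
  have "connected V"
  proof -
    \<comment> \<open>\<open>V\<close> is the increasing union of closed sublevel sets, which are
      known to be connected and share the point 0.\<close>
    have "\<exists>r\<in>{?R..<\<rho>}. norm (?P z) \<le> r" if "z \<in> V" for z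
      using that \<rho> by (intro bexI[of _ "max ?R (norm (?P z))"]) (auto simp: V_def)
    then have "V = \<Union>((\<lambda>r. {z. norm (?P z) \<le> r}) ` {?R..<\<rho>})"
      by (force simp: V_def)
    moreover have "0 \<in> {z. norm (?P z) \<le> r}" if "?R \<le> r" for r
      using below[of K] K that by simp
    then have "0 \<in> \<Inter>((\<lambda>r. {z. norm (?P z) \<le> r}) ` {?R..<\<rho>})"
      by simp
    then have "connected (\<Union>((\<lambda>r. {z. norm (?P z) \<le> r}) ` {?R..<\<rho>}))"
      using inner[of K] by (intro connected_Union) auto
    ultimately show ?thesis
      by simp
  qed
  moreover have "connected (- V)"
    using connected_outer_level[of c \<rho> K] \<rho> by (simp add: V_def Compl_eq not_less)
  \<comment> \<open>A bounded open connected set with connected complement is simply connected, so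
    \<open>z - c\<close>, zero-free on \<open>V\<close>, has a holomorphic square root
    there.\<close>
  ultimately have "simply_connected V"
    using \<open>open V\<close> \<open>bounded V\<close> by (simp add: simply_connected_iff_simple)
  moreover have "c \<notin> V"
    using \<rho> by (simp add: V_def)
  moreover have "(\<lambda>z. z - c) holomorphic_on V"
    by (intro holomorphic_intros)
  ultimately obtain h where h: "h holomorphic_on V" "\<And>z. z \<in> V \<Longrightarrow> z - c = (h z)\<^sup>2"
    unfolding simply_connected_eq_holomorphic_sqrt[OF \<open>open V\<close>] by (metis eq_iff_diff_eq_0)
  have "quad_sqrt_branch c V h"
  proof
    show "quad_map c (h z) = z" if "z \<in> V" for z
      unfolding quad_map_def h(2)[OF that, symmetric] by simp
  qed (use h \<open>c \<notin> V\<close> vimage_V in auto)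
  moreover have "connected {z. norm (?P z) = r}" if r: "?R \<le> r" for r
  proof -
    have closed: "closed {z. norm (?P z) \<le> r}" "closed {z. r \<le> norm (?P z)}"
      by (intro closed_Collect_le continuous_intros continuous_quad_map_iter)+
    \<comment> \<open>The plane is unicoherent: two closed connected sets that cover it have a
      connected intersection, here the level set.\<close>
    have "connected ({z. norm (?P z) \<le> r} \<inter> {z. r \<le> norm (?P z)})"
    proof (rule unicoherentD[OF unicoherent_UNIV])
      show "connected {z. norm (?P z) \<le> r}"
        using inner r by blast
      show "connected {z. r \<le> norm (?P z)}"
        using connected_outer_level r by blast
    qed (use closed in auto)
    moreover have "{z. norm (?P z) \<le> r} \<inter> {z. r \<le> norm (?P z)} = {z. norm (?P z) = r}"
      by auto
    ultimately show ?thesis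
      by simp
  qed
  ultimately show ?thesis
    using that[of \<rho> K h] \<rho> inner unfolding V_def by blast
qed

text \<open>The areas of any finitely many members add up to at most the area of one disc containing
  them all.\<close>

lemma small_member_of_disjoint_family:
  fixes U :: "nat \<Rightarrow> complex set"
  assumes disj: "disjoint_family U" and op: "\<And>n. open (U n)" and bdd: "bounded (\<Union>n. U n)" and "0 < \<delta>"
  shows "\<exists>n. measure lborel (U n) < \<delta>"
proof (rule ccontr)
  assume "\<not> ?thesis"
  then have ge: "\<delta> \<le> measure lborel (U n)" for n
    by (simp add: not_less)
  obtain B where "\<forall>z\<in>(\<Union>n. U n). norm z \<le> B"
    using bdd unfolding bounded_iff by blast
  then have B: "(\<Union>n. U n) \<subseteq> cball 0 B"
    by auto
  have fm: "cball 0 B \<in> fmeasurable (lborel :: complex measure)"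
    by (intro fmeasurable_compact compact_cball)
  have fin: "U n \<in> fmeasurable lborel" for n
    using fm by (rule fmeasurableI2) (use B op in auto)
  have "real N * \<delta> \<le> measure lborel (cball (0::complex) B)" for N
  proof -
    have "real N * \<delta> \<le> (\<Sum>n<N. measure lborel (U n))"
      using sum_bounded_below[of "{..<N}" \<delta> "\<lambda>n. measure lborel (U n)"] ge by simp
    also have "\<dots> = measure lborel (\<Union>n\<in>{..<N}. U n)"
    proof (rule measure_finite_Union[symmetric])
      show "disjoint_family_on U {..<N}"
        using disj by (rule disjoint_family_on_mono[rotated]) simp
      show "U ` {..<N} \<subseteq> sets lborel"
        using op by auto
      show "emeasure lborel (U n) \<noteq> \<infinity>" for n
        using fin[of n] by (auto simp: fmeasurable_def)
    qed simp
    also have "\<dots> \<le> measure lborel (cball (0::complex) B)"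
      using B fm op by (intro measure_mono_fmeasurable) auto
    finally show ?thesis .
  qed
  moreover obtain N :: nat where "measure lborel (cball (0::complex) B) / \<delta> < real N"
    using reals_Archimedean2 by blast
  ultimately show False
    using \<open>0 < \<delta>\<close> by (metis not_less pos_divide_less_eq)
qed

section \<open>Bounded univalent functions\<close>

text \<open>The sphere is replaced by the plane: \<open>l\<close> stands for the value at infinity,
  and the last hypothesis is injectivity at infinity.\<close>

lemma bounded_univalent_impossible:
  fixes \<phi> :: "complex \<Rightarrow> complex"
  assumes c: "c \<notin> mandelbrot"
    and hol: "\<phi> holomorphic_on - julia c" and inj: "inj_on \<phi> (- julia c)"
    and bdd: "bounded (\<phi> ` (- julia c))"
    and lim: "(\<phi> \<longlongrightarrow> l) at_infinity" and l: "l \<notin> \<phi> ` (- julia c)"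
  shows False
proof -
  obtain K \<rho> h where \<rho>: "norm c + 2 < \<rho>" "\<rho> \<le> 2 * (norm c + 2)"
    and branch: "quad_sqrt_branch c {z. norm ((quad_map c ^^ K) z) < \<rho>} h"
    and compact_level: "\<And>r. norm c + 2 \<le> r \<Longrightarrow> compact {z. norm ((quad_map c ^^ K) z) \<le> r}"
    and connected_level: "\<And>r. norm c + 2 \<le> r \<Longrightarrow> connected {z. norm ((quad_map c ^^ K) z) = r}"
    using escaping_quad_structure[OF c] by metis
  define P where "P = quad_map c ^^ K"
  define R where "R = norm c + 2"
  \<comment> \<open>A level strictly between \<open>R\<close> and \<rho> places \<Gamma> inside the
    ring \<open>A\<close>; \<open>T\<close> is the compact set that it bounds.\<close>
  define r where "r = (R + \<rho>) / 2"
  define V where "V = {z. norm (P z) < \<rho>}"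
  define A where "A = {z. R < norm (P z) \<and> norm (P z) < \<rho>}"
  define T where "T = {z. norm (P z) \<le> r}"
  define \<Gamma> where "\<Gamma> = {z. norm (P z) = r}"
  define W where "W n = {w :: bool list. length w = n}" for n
  interpret quad_sqrt_branch c V h
    using branch by (simp add: V_def P_def)
  have "R > 0"
    unfolding R_def by (rule add_nonneg_pos) auto
  then have r: "R < r" "r < \<rho>" "R > 0"
    using \<rho> by (simp_all add: r_def R_def)
  have contP: "continuous_on S P" for S
    unfolding P_def by (rule continuous_quad_map_iter)
  have "open A"
    unfolding A_def by (intro open_Collect_conj open_Collect_less continuous_intros contP)
  have compT: "compact T"
    using compact_level r unfolding T_def P_def R_def by simp
  have "closed \<Gamma>"
    unfolding \<Gamma>_def by (intro closed_Collect_eq continuous_intros contP)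
  then have "compact \<Gamma>"
    using compact_Int_closed[OF compT, of \<Gamma>] by (simp add: Int_absorb1 T_def \<Gamma>_def subset_iff)
  have "connected \<Gamma>"
    using connected_level r unfolding \<Gamma>_def P_def R_def by simp
  have sub: "A \<subseteq> V" "T \<subseteq> V" "\<Gamma> \<subseteq> A" "\<Gamma> \<subseteq> T"
    using r by (auto simp: A_def V_def T_def \<Gamma>_def)
  have finW: "finite (W n)" for n
    using finite_lists_length_eq[of "UNIV :: bool set" n] by (simp add: W_def)
  \<comment> \<open>These iterates undo the branch and then apply \<open>P\<close>, which shows that
    the copies of \<open>A\<close> escape and so lie off the Julia set.\<close>
  have iter: "(quad_map c ^^ (K + length w)) (branch h w z) = P z" if "z \<in> V" for w z
    using quad_iter_branch[OF that, of w] by (simp add: funpow_add P_def)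
  have esc: "z \<in> - julia c" if "R < norm ((quad_map c ^^ n) z)" for n z
    using escape_not_in_julia[of c n z] that by (simp add: R_def)
  have far: "\<rho> \<le> norm ((quad_map c ^^ n) z)" if "\<rho> \<le> norm z" for n z
    using norm_quad_map_iter_ge_self[of c z n] that \<rho> by linarith
  have branchA: "branch h w ` A \<subseteq> - julia c" for w
  proof
    fix y
    assume "y \<in> branch h w ` A"
    then obtain z where z: "z \<in> A" "y = branch h w z"
      by blast
    have "R < norm ((quad_map c ^^ (K + length w)) y)"
      using iter[of z w] z sub by (auto simp: A_def)
    then show "y \<in> - julia c"
      by (rule esc)
  qed
  have openJ: "open (- julia c)"
    by (simp add: julia_def open_Compl)
  \<comment> \<open>Composing with the branch moves every copy back to the one ring
    \<open>A\<close>, where the area estimate has a single constant.\<close>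
  define \<psi> where "\<psi> w = \<phi> \<circ> branch h w" for w
  have hol\<psi>: "\<psi> w holomorphic_on A" for w
    unfolding \<psi>_def
    by (intro holomorphic_on_compose holomorphic_on_subset[OF holomorphic_branch]
        holomorphic_on_subset[OF hol] branchA sub)
  have inj\<psi>: "inj_on (\<psi> w) A" for w
    unfolding \<psi>_def
    by (intro comp_inj_on inj_on_subset[OF inj_on_branch] inj_on_subset[OF inj] branchA sub)
  have open\<psi>: "open (\<psi> w ` A)" for w
    using hol\<psi> inj\<psi> \<open>open A\<close> by (intro open_mapping_thm3)
  obtain B where "\<And>z. z \<in> \<phi> ` (- julia c) \<Longrightarrow> norm z \<le> B"
    using bdd unfolding bounded_iff by metis
  then have B: "\<phi> ` (- julia c) \<subseteq> cball 0 B"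
    by auto
  have \<psi>sub: "\<psi> w ` A \<subseteq> \<phi> ` (- julia c)" for w
    using branchA[of w] unfolding \<psi>_def image_comp[symmetric] by (rule image_mono)
  have fm: "\<psi> w ` A \<in> fmeasurable lborel" for w
    using \<psi>sub[of w] B open\<psi>[of w]
    by (intro fmeasurableI2[OF fmeasurable_compact[OF compact_cball[of 0 B]]]) auto
  obtain C where C: "0 \<le> C"
    "\<And>F x y. \<lbrakk>F holomorphic_on A; F ` A \<in> fmeasurable lborel; x \<in> \<Gamma>; y \<in> \<Gamma>\<rbrakk>
        \<Longrightarrow> (dist (F x) (F y))\<^sup>2 \<le> C * measure lborel (F ` A)"
    using dist_squared_le_area[OF \<open>open A\<close> \<open>compact \<Gamma>\<close> \<open>connected \<Gamma>\<close> sub(3)] by metis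
  define a where "a w = measure lborel (\<psi> w ` A)" for w
  define U where "U n = (\<Union>w\<in>W n. \<psi> w ` A)" for n
  have unique: "w = w'" if "\<psi> w z = \<psi> w' z'" "z \<in> A" "z' \<in> A" for w w' z z'
  proof -
    have eq: "branch h w z = branch h w' z'"
    proof (rule inj_onD[OF inj])
      show "\<phi> (branch h w z) = \<phi> (branch h w' z')"
        using that(1) by (simp add: \<psi>_def)
      show "branch h w z \<in> - julia c" "branch h w' z' \<in> - julia c"
        using branchA that(2,3) by blast+
    qed
    \<comment> \<open>If \<open>v'\<close> were longer, \<open>y\<close> would already have norm
      above \<open>R\<close>, and the \<open>Suc k\<close> further iterates belonging to
      \<open>v'\<close> would take it to norm at least \<open>2 * R\<close>, hence not below
      \<rho>.\<close>
    have aux: "length v' \<le> length v" if "branch h v z = branch h v' z'" "z \<in> A" "z' \<in> A" for v v' z z'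
    proof (rule ccontr)
      assume "\<not> ?thesis"
      then obtain k where k: "length v' = length v + Suc k"
        using less_imp_Suc_add[of "length v" "length v'"] by auto
      define y where "y = (quad_map c ^^ (K + length v)) (branch h v z)"
      have "R < norm y"
        using iter[of z v] that sub by (auto simp: A_def y_def)
      then have "2 ^ Suc k * R \<le> 2 ^ Suc k * norm y"
        by (intro mult_left_mono) auto
      also have "\<dots> \<le> norm ((quad_map c ^^ Suc k) y)"
        using \<open>R < norm y\<close> by (intro norm_quad_map_iter_ge) (simp add: R_def)
      also have "(quad_map c ^^ Suc k) y = (quad_map c ^^ (Suc k + (K + length v))) (branch h v' z')"
        unfolding y_def that(1) funpow_add by simp
      also have "Suc k + (K + length v) = K + length v'"
        using k by simp
      also have "norm ((quad_map c ^^ (K + length v')) (branch h v' z')) < \<rho>"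
        using iter[of z' v'] that sub by (auto simp: A_def)
      finally have "2 ^ Suc k * R < \<rho>" .
      moreover have "2 * R \<le> 2 ^ Suc k * R"
        using r(3) by (intro mult_right_mono) auto
      ultimately show False
        using \<rho> by (simp add: R_def)
    qed
    have "length w = length w'"
      using aux[OF eq] aux[OF eq[symmetric]] that by simp
    then show ?thesis
      using branch_unique[OF _ eq] that sub by blast
  qed
  have small_U: "\<exists>n. measure lborel (U n) < \<delta>" if "\<delta> > 0" for \<delta>
  proof (rule small_member_of_disjoint_family[OF _ _ _ that])
    show "disjoint_family U"
      unfolding disjoint_family_on_def
    proof (intro ballI impI)
      fix m n :: nat
      assume "m \<noteq> n"
      have False if "y \<in> U m" "y \<in> U n" for y
      proof -
        obtain w z where w: "w \<in> W m" "z \<in> A" "y = \<psi> w z"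
          using \<open>y \<in> U m\<close> by (auto simp: U_def)
        obtain w' z' where w': "w' \<in> W n" "z' \<in> A" "y = \<psi> w' z'"
          using \<open>y \<in> U n\<close> by (auto simp: U_def)
        have "w = w'"
          using unique[of w z w' z'] w w' by simp
        then show False
          using w(1) w'(1) \<open>m \<noteq> n\<close> by (simp add: W_def)
      qed
      then show "U m \<inter> U n = {}"
        by blast
    qed
    show "open (U n)" for n
      using open\<psi> by (auto simp: U_def)
    show "bounded (\<Union>n. U n)"
      using \<psi>sub by (intro bounded_subset[OF bdd]) (auto simp: U_def)
  qed
  have measure_U: "measure lborel (U n) = (\<Sum>w\<in>W n. a w)" for n
    unfolding U_def a_def
  proof (rule measure_finite_Union)
    show "disjoint_family_on (\<lambda>w. \<psi> w ` A) (W n)"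
      unfolding disjoint_family_on_def using unique by blast
    show "(\<lambda>w. \<psi> w ` A) ` W n \<subseteq> sets lborel"
      using fm by blast
    show "emeasure lborel (\<psi> w ` A) \<noteq> \<infinity>" for w
      using fm[of w] by (auto simp: fmeasurable_def)
  qed (rule finW)

  \<comment> \<open>Near infinity the glued map will agree with \<phi>; the value to be taken only
    once is sought among the values of \<phi> here.\<close>
  define Out where "Out = {z::complex. \<rho> < norm z}"
  have "open Out"
    unfolding Out_def by (intro open_Collect_less continuous_intros)
  have OutJ: "Out \<subseteq> - julia c"
    using esc[of 0] \<rho> by (auto simp: Out_def R_def)
  have "open (\<phi> ` Out)"
    using holomorphic_on_subset[OF hol OutJ] \<open>open Out\<close> inj_on_subset[OF inj OutJ]
    by (rule open_mapping_thm3)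
  moreover have "of_real (\<bar>\<rho>\<bar> + 1) \<in> Out"
    unfolding Out_def mem_Collect_eq norm_of_real by linarith
  ultimately obtain e where be: "e > 0" "ball (\<phi> (of_real (\<bar>\<rho>\<bar> + 1))) e \<subseteq> \<phi> ` Out"
    by (meson image_eqI open_contains_ball)
  define b where "b = \<phi> (of_real (\<bar>\<rho>\<bar> + 1))"
  note be = be[folded b_def]
  \<comment> \<open>The discs \<open>D w\<close> will have total area at most \<open>pi * C\<close>
    times the sum of the \<open>a w\<close>, so less than \<open>ball b e\<close>. Taking
    \<open>C + 1\<close> avoids division by 0.\<close>
  have "0 < measure lborel (ball b e) / (pi * (C + 1))"
    using content_ball_pos[OF be(1), of b] C(1) by simp
  then obtain n where n: "(\<Sum>w\<in>W n. a w) < measure lborel (ball b e) / (pi * (C + 1))"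
    using small_U unfolding measure_U by blast

  \<comment> \<open>Were \<Gamma> empty, the choice would be arbitrary, but the fact
    \<open>D\<close> below would then claim nothing.\<close>
  define x0 where "x0 = (SOME x. x \<in> \<Gamma>)"
  define D where "D w = cball (\<psi> w x0) (sqrt (C * a w))" for w
  have D: "\<psi> w x \<in> D w" if "x \<in> \<Gamma>" for w x
  proof -
    have "x0 \<in> \<Gamma>"
      unfolding x0_def using that by (rule someI)
    then show ?thesis
      using C(2)[OF hol\<psi> fm _ that, of x0 w] by (simp add: D_def a_def real_le_rsqrt)
  qed
  have a_nonneg: "0 \<le> a w" for w
    by (simp add: a_def)
  obtain p where p: "p \<in> ball b e" "\<And>w. w \<in> W n \<Longrightarrow> p \<notin> D w"
  proof -
    have "measure lborel (\<Union>w\<in>W n. D w) \<le> (\<Sum>w\<in>W n. measure lborel (D w))"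
      using finW by (intro measure_UNION_le) (auto simp: D_def)
    also have "\<dots> = pi * C * (\<Sum>w\<in>W n. a w)"
      unfolding D_def sum_distrib_left using C(1) a_nonneg
      by (intro sum.cong refl) (simp add: content_cball unit_ball_vol_2)
    also have "\<dots> \<le> pi * (C + 1) * (\<Sum>w\<in>W n. a w)"
      using a_nonneg by (intro mult_right_mono sum_nonneg) auto
    also have "\<dots> < measure lborel (ball b e)"
      using n C(1) by (simp add: pos_less_divide_eq mult.commute)
    finally have "measure lborel (\<Union>w\<in>W n. D w) < measure lborel (ball b e)" .
    moreover have "(\<Union>w\<in>W n. D w) \<in> fmeasurable lborel"
      using finW by (intro fmeasurable_compact compact_UN) (auto simp: D_def)
    ultimately have "\<not> ball b e \<subseteq> (\<Union>w\<in>W n. D w)"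
      using measure_mono_fmeasurable[of "ball b e" "\<Union>w\<in>W n. D w" lborel] by auto
    then show ?thesis
      using that by blast
  qed
  then obtain z0 where z0: "z0 \<in> Out" "p = \<phi> z0"
    using be(2) by blast

  have closed_branchT: "closed (branch h w ` T)" "closed (branch h w ` \<Gamma>)" for w
    using sub compT \<open>compact \<Gamma>\<close>
    by (auto intro!: compact_imp_closed compact_continuous_image
        continuous_on_subset[OF holomorphic_on_imp_continuous_on[OF holomorphic_branch]])
  \<comment> \<open>Dugundji's theorem extends \<phi> from the copy of \<Gamma> with values in the
    convex disc \<open>D w\<close>.\<close>
  have "\<exists>g. continuous_on UNIV g \<and> range g \<subseteq> D w \<and> (\<forall>x\<in>branch h w ` \<Gamma>. g x = \<phi> x)" for w
  proof -
    have cont: "continuous_on (branch h w ` \<Gamma>) \<phi>"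
      using branchA[of w] sub by (intro continuous_on_subset[OF holomorphic_on_imp_continuous_on[OF hol]]) blast
    have im: "\<phi> ` branch h w ` \<Gamma> \<subseteq> D w"
      using D[of _ w] by (simp add: \<psi>_def image_subset_iff)
    have convex: "convex (D w)"
      by (simp add: D_def)
    have "0 \<le> C * a w"
      using C(1) a_nonneg by (rule mult_nonneg_nonneg)
    then have ne: "D w \<noteq> {}"
      by (simp add: D_def)
    have closedin: "closedin (top_of_set UNIV) (branch h w ` \<Gamma>)"
      using closed_branchT(2)[of w] by simp
    show ?thesis
    proof (rule Dugundji[OF convex ne closedin cont im])
      fix g
      assume "continuous_on UNIV g" "range g \<subseteq> D w" "\<And>x. x \<in> branch h w ` \<Gamma> \<Longrightarrow> g x = \<phi> x"
      then show ?thesis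
        by (intro exI[of _ g] conjI ballI)
    qed
  qed
  then have "\<forall>w. \<exists>g. continuous_on UNIV g \<and> range g \<subseteq> D w \<and> (\<forall>x\<in>branch h w ` \<Gamma>. g x = \<phi> x)"
    by (rule allI)
  from choice[OF this] obtain g where g_all: "\<forall>w. continuous_on UNIV (g w) \<and> range (g w) \<subseteq> D w \<and>
      (\<forall>x\<in>branch h w ` \<Gamma>. g w x = \<phi> x)" ..
  have g: "continuous_on UNIV (g w)" "g w x \<in> D w"
    "x \<in> \<Gamma> \<Longrightarrow> g w (branch h w x) = \<phi> (branch h w x)" for w x
    using g_all[THEN spec, of w] by (simp_all add: image_subset_iff)
  \<comment> \<open>\<open>E\<close> and the level-\<open>n\<close> copies of \<open>T\<close> cover
    the plane, and \<open>E\<close> meets these copies only along copies of \<Gamma>. The map \<phi>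
    is kept on \<open>E\<close> and replaced on the copies of \<open>T\<close>.\<close>
  define E where "E = {z. r \<le> norm ((quad_map c ^^ (K + n)) z)}"
  have EJ: "E \<subseteq> - julia c"
    using esc[of "K + n"] r by (auto simp: E_def)
  have "closed E"
    unfolding E_def by (intro closed_Collect_le continuous_intros continuous_quad_map_iter)
  have cover: "\<exists>w\<in>W n. z \<in> branch h w ` T" if "z \<notin> E" for z
  proof -
    let ?y = "(quad_map c ^^ n) z"
    have "norm (P ?y) < r"
      using that by (simp add: E_def P_def funpow_add)
    then have "?y \<in> T"
      by (simp add: T_def)
    then have "?y \<in> V"
      using sub(2) by (rule rev_subsetD)
    from branch_surj[OF this] obtain w where "length w = n" "branch h w ?y = z"
      by (elim exE conjE)
    then have "w \<in> W n" "z \<in> branch h w ` T"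
      using imageI[OF \<open>?y \<in> T\<close>, of "branch h w"] by (simp_all add: W_def)
    then show ?thesis
      by (rule bexI[rotated])
  qed
  have overlap: "g w z = \<phi> z" if w: "w \<in> W n" "z \<in> E" and z: "z \<in> branch h w ` T" for w z
  proof -
    obtain x where x: "x \<in> T" "z = branch h w x"
      using z by (elim imageE)
    then have "(quad_map c ^^ (K + n)) z = P x"
      using iter[of x w] w sub by (auto simp: W_def)
    then have "x \<in> \<Gamma>"
      using x w by (simp add: E_def T_def \<Gamma>_def)
    then show ?thesis
      using g(3) x by simp
  qed
  \<comment> \<open>\<open>None\<close> marks the outer piece and \<open>Some w\<close> the copy of
    \<open>T\<close> under \<open>branch h w\<close>: a finite closed cover, ready for
    pasting.\<close>
  define S where "S i = (case i of None \<Rightarrow> E | Some w \<Rightarrow> branch h w ` T)" for i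
  define s where "s i = (case i of None \<Rightarrow> \<phi> | Some w \<Rightarrow> g w)" for i
  obtain F where "continuous_map (euclidean :: complex topology) (euclidean :: complex topology) F"
    and F: "\<And>x i. \<lbrakk>i \<in> insert None (Some ` W n); x \<in> topspace euclidean \<inter> S i\<rbrakk> \<Longrightarrow> F x = s i x"
  proof (rule pasting_lemma_exists_closed[of "insert None (Some ` W n)" euclidean S euclidean s])
    show "finite (insert None (Some ` W n))"
      using finW by simp
    show "topspace euclidean \<subseteq> \<Union> (S ` insert None (Some ` W n))"
      using cover by (auto simp: S_def)
    show "closedin euclidean (S i)" if "i \<in> insert None (Some ` W n)" for i
      using that closed_branchT \<open>closed E\<close> by (auto simp: S_def)
    show "continuous_map (subtopology euclidean (S i)) euclidean (s i)"
      if "i \<in> insert None (Some ` W n)" for i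
      using that holomorphic_on_imp_continuous_on[OF holomorphic_on_subset[OF hol EJ]]
        continuous_on_subset[OF g(1) subset_UNIV]
      by (auto simp: S_def s_def)
    show "s i x = s j x" if "i \<in> insert None (Some ` W n)" "j \<in> insert None (Some ` W n)"
      "x \<in> topspace euclidean \<inter> S i \<inter> S j" for i j x
    proof -
      \<comment> \<open>Copies of \<open>T\<close> for different words of length \<open>n\<close>
        are disjoint, so compatibility is only at stake between \<open>E\<close> and a copy.\<close>
      have same: "w = w'" if w: "x \<in> branch h w ` T" and w': "x \<in> branch h w' ` T"
        and W: "w \<in> W n" "w' \<in> W n" for w w'
      proof -
        obtain y where y: "y \<in> T" "x = branch h w y"
          using w by (elim imageE)
        obtain y' where y': "y' \<in> T" "x = branch h w' y'"
          using w' by (elim imageE)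
        show ?thesis
          using branch_unique[of w w' y y'] W y y' sub by (auto simp: W_def)
      qed
      show ?thesis
      proof (cases i)
        case None
        then show ?thesis
          using that overlap[of _ x] by (cases j) (auto simp: S_def s_def)
      next
        case (Some w)
        then show ?thesis
          using that overlap[of w x] same[of w] by (cases j) (auto simp: S_def s_def)
      qed
    qed
  qed (rule that)
  then have contF: "continuous_on UNIV F"
    by simp
  have FE: "F z = \<phi> z" if "z \<in> E" for z
    using F[of None z] that by (simp add: S_def s_def)
  have OutE: "z \<in> E" if "\<rho> \<le> norm z" for z
    using far[OF that, of "K + n"] r by (simp add: E_def)
  have z0E: "z0 \<in> E"
    using OutE z0 by (simp add: Out_def)
  show False
  proof (rule unique_simple_value_impossible[OF contF])
    show "(F \<longlongrightarrow> l) at_infinity"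
    proof (rule Lim_transform_eventually[OF lim])
      show "\<forall>\<^sub>F z in at_infinity. \<phi> z = F z"
        unfolding eventually_at_infinity using OutE FE by (intro exI[of _ \<rho>]) simp
    qed
    show "l \<noteq> F z0"
      using l z0E EJ FE[OF z0E] by auto
    \<comment> \<open>On \<open>E\<close> this is injectivity of \<phi>; elsewhere the values lie in
      discs \<open>D w\<close> that miss \<open>p\<close>, the value at \<open>z0\<close>.\<close>
    show "z = z0" if "F z = F z0" for z
    proof (cases "z \<in> E")
      case True
      then show ?thesis
        using inj_onD[OF inj, of z z0] that FE[OF True] FE[OF z0E] subsetD[OF EJ True] subsetD[OF EJ z0E]
        by simp
    next
      case False
      from cover[OF this] obtain w where w: "w \<in> W n" "z \<in> branch h w ` T"
        by (elim bexE)
      then have "F z = g w z"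
        using F[of "Some w" z] by (simp add: S_def s_def)
      then have "p \<in> D w"
        using g(2)[of w z] that FE[OF z0E] z0 by simp
      then show ?thesis
        using p(2)[OF w(1)] by simp
    qed
    have "(\<phi> has_field_derivative deriv \<phi> z0) (at z0)"
      using holomorphic_derivI[OF hol openJ] z0 OutJ by blast
    then show "(F has_field_derivative deriv \<phi> z0) (at z0)"
      by (rule has_field_derivative_transform_within_open[OF _ \<open>open Out\<close> z0(1)])
        (use FE OutE in \<open>simp add: Out_def\<close>)
    show "deriv \<phi> z0 \<noteq> 0"
      using holomorphic_injective_imp_regular[OF hol openJ inj] z0 OutJ by blast
  qed
qed

theorem theorem1p3:
  fixes c :: complex
  assumes "c \<notin> mandelbrot"
  shows "\<not> (\<exists>f :: complex option \<Rightarrow> complex.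
            sphere_holomorphic_on f (UNIV - Some ` julia c) \<and>
            inj_on f (UNIV - Some ` julia c) \<and>
            bounded (f ` (UNIV - Some ` julia c)))"
proof
  assume "\<exists>f :: complex option \<Rightarrow> complex.
            sphere_holomorphic_on f (UNIV - Some ` julia c) \<and>
            inj_on f (UNIV - Some ` julia c) \<and>
            bounded (f ` (UNIV - Some ` julia c))"
  then obtain f :: "complex option \<Rightarrow> complex"
    where f: "sphere_holomorphic_on f (UNIV - Some ` julia c)"
      "inj_on f (UNIV - Some ` julia c)" "bounded (f ` (UNIV - Some ` julia c))"
    by blast
  let ?\<Omega> = "UNIV - Some ` julia c"
  have Compl: "{z. Some z \<in> ?\<Omega>} = - julia c"
    by auto
  have sub: "Some z \<in> ?\<Omega>" if "z \<in> - julia c" for z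
    using that by auto
  have lim: "((\<lambda>z. f (Some z)) \<longlongrightarrow> f None) at_infinity"
  proof -
    let ?S = "{w. chart_inf w \<in> ?\<Omega>}" and ?k = "\<lambda>w. f (chart_inf w)"
    have "?k holomorphic_on ?S"
      using f(1) by (auto simp: sphere_holomorphic_on_def)
    \<comment> \<open>For nonzero \<open>w\<close> in this ball, \<open>inverse w\<close> lies
      beyond the escape radius, so iterate 0 already shows that it is off the Julia set.\<close>
    moreover have "ball 0 (inverse (norm c + 2)) \<subseteq> ?S"
    proof
      fix w :: complex
      assume w: "w \<in> ball 0 (inverse (norm c + 2))"
      have "inverse w \<notin> julia c" if "w \<noteq> 0"
      proof (rule escape_not_in_julia[of c 0])
        have "norm c + 2 < inverse (norm w)"
          using w that norm_ge_zero[of c] less_imp_inverse_less[of "norm w" "inverse (norm c + 2)"]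
          by (simp del: norm_ge_zero)
        then show "norm c + 2 < norm ((quad_map c ^^ 0) (inverse w))"
          by (simp add: norm_inverse)
      qed
      then show "w \<in> ?S"
        by (auto simp: chart_inf_def)
    qed
    ultimately have "continuous_on (ball 0 (inverse (norm c + 2))) ?k"
      by (meson continuous_on_subset holomorphic_on_imp_continuous_on)
    moreover have "0 \<in> ball (0::complex) (inverse (norm c + 2))"
      using norm_ge_zero[of c] by (simp add: add_nonneg_pos del: norm_ge_zero)
    ultimately have "isCont ?k 0"
      using continuous_on_eq_continuous_at open_ball by blast
    then have "(?k \<longlongrightarrow> f None) (at 0)"
      by (simp add: isCont_def chart_inf_def)
    moreover have "filterlim (\<lambda>z. inverse z) (at (0::complex)) at_infinity"
      using filterlim_inverse_at_iff[of "\<lambda>u::complex. u" at_infinity] by (simp add: filterlim_ident)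
    ultimately have "((\<lambda>z. ?k (inverse z)) \<longlongrightarrow> f None) at_infinity"
      by (rule filterlim_compose)
    moreover have "\<forall>\<^sub>F z in at_infinity. ?k (inverse z) = f (Some z)"
      unfolding eventually_at_infinity by (intro exI[of _ 1]) (auto simp: chart_inf_def)
    ultimately show ?thesis
      by (rule Lim_transform_eventually)
  qed
  show False
  proof (rule bounded_univalent_impossible[OF assms _ _ _ lim])
    show "(\<lambda>z. f (Some z)) holomorphic_on - julia c"
      using f(1) unfolding sphere_holomorphic_on_def Compl by blast
    show "inj_on (\<lambda>z. f (Some z)) (- julia c)"
      using inj_onD[OF f(2)] sub by (intro inj_onI) blast
    show "bounded ((\<lambda>z. f (Some z)) ` (- julia c))"
      using sub by (intro bounded_subset[OF f(3)]) blast
    show "f None \<notin> (\<lambda>z. f (Some z)) ` (- julia c)"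
      using inj_onD[OF f(2), of None] sub by blast
  qed
qed

end
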